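(* Let $\kappa:\mathbf{C}^{2n}\to\mathbf{C}^{2n}$ be a complex linear canonical transformation and let $\Phi_1,\Phi_2$ be strictly plurisubharmonic quadratic forms on $\mathbf{C}^n$. Then $\kappa$ is positive relative to $(\Lambda_{\Phi_1},\Lambda_{\Phi_2})$ if and only if $$\kappa(\Lambda_{\Phi_2})=\Lambda_{\Phi}$$ for some strictly plurisubharmonic quadratic form $\Phi$ on $\mathbf{C}^n$ such that $\Phi\le\Phi_1$ (pointwise on $\mathbf{C}^n$).
   Context: A strictly plurisubharmonic quadratic form on $\mathbf{C}^n$ is a real-valued quadratic form $\Phi$ on $\mathbf{C}^n\simeq\mathbf{R}^{2n}$ whose Levi matrix $\Phi''_{x\bar x}=(\partial_{x_j}\partial_{\bar x_k}\Phi)$ is positive definite. $\mathbf{C}^{2n}=\mathbf{C}^n_x\times\mathbf{C}^n_\xi$ carries the standard complex symplectic form $\sigma((x,\xi),(y,\eta))=\xi\cdot y-x\cdot\eta$, where $a\cdot b=\sum_j a_jb_j$ is the complex bilinear product. A complex linear canonical transformation is a complex linear bijection $\kappa$ of $\mathbf{C}^{2n}$ with $\kappa^*\sigma=\sigma$. For a real-valued quadratic form $\Phi$ on $\mathbf{C}^n$, set $\Lambda_\Phi=\{(x,\frac{2}{i}\frac{\partial\Phi}{\partial x}(x)):x\in\mathbf{C}^n\}\subset\mathbf{C}^{2n}$, where $\partial/\partial x$ is the holomorphic derivative. If $\Phi$ is strictly plurisubharmonic, then $\Lambda_\Phi$ is maximally totally real, and $\iota_\Phi:\mathbf{C}^{2n}\to\mathbf{C}^{2n}$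 denotes the unique antilinear involution which is the identity on $\Lambda_\Phi$. A complex linear canonical transformation $\kappa$ is positive relative to $(\Lambda_{\Phi_1},\Lambda_{\Phi_2})$ if $$\frac1i\Big(\sigma(\kappa(\rho),\iota_{\Phi_1}\kappa(\rho))-\sigma(\rho,\iota_{\Phi_2}(\rho))\Big)\ge0\quad\text{for all }\rho\in\mathbf{C}^{2n}.$$ *)

theory Defs
  imports "HOL-Analysis.Analysis" "HOL-Library.Complex_Order"
begin

definition quadratic_form :: "('a::real_vector \<Rightarrow> real) \<Rightarrow> bool" where
  "quadratic_form \<Phi> \<longleftrightarrow> (\<exists>B. bilinear B \<and> (\<forall>x. \<Phi> x = B x x))"

text \<open>
  Writing \<open>x\<^sub>j = a\<^sub>j + \<i> b\<^sub>j\<close>, the directions of \<open>a\<^sub>j\<close> and \<open>b\<^sub>j\<close> are \<open>axis j 1\<close> and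
  \<open>axis j \<i>\<close>; the Frechet derivatives below are derivatives over the reals.
\<close>

definition dz :: "'n \<Rightarrow> (complex ^ 'n::finite \<Rightarrow> complex) \<Rightarrow> complex ^ 'n \<Rightarrow> complex" where
  "dz j f x = (frechet_derivative f (at x) (axis j 1)
               - \<i> * frechet_derivative f (at x) (axis j \<i>)) / 2"

definition dzbar :: "'n \<Rightarrow> (complex ^ 'n::finite \<Rightarrow> complex) \<Rightarrow> complex ^ 'n \<Rightarrow> complex" where
  "dzbar j f x = (frechet_derivative f (at x) (axis j 1)
                  + \<i> * frechet_derivative f (at x) (axis j \<i>)) / 2"

definition holomorphic_gradient :: "(complex ^ 'n::finite \<Rightarrow> real) \<Rightarrow> complex ^ 'n \<Rightarrow> complex ^ 'n" where
  "holomorphic_gradient \<Phi> x = (\<chi> j. dz j (\<lambda>y. complex_of_real (\<Phi> y)) x)"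

definition levi_matrix :: "(complex ^ 'n::finite \<Rightarrow> real) \<Rightarrow> complex ^ 'n \<Rightarrow> complex ^ 'n ^ 'n" where
  "levi_matrix \<Phi> x = (\<chi> j k. dz j (dzbar k (\<lambda>y. complex_of_real (\<Phi> y))) x)"

text \<open>
  For complex \<open>z\<close>, \<open>0 < z\<close> and \<open>0 \<le> z\<close> from \<open>Complex_Order\<close> include that \<open>z\<close> is real, so the
  definition below implies that \<open>A\<close> is Hermitian.
\<close>

definition positive_definite :: "complex ^ 'n ^ 'n::finite \<Rightarrow> bool" where
  "positive_definite A \<longleftrightarrow>
     (\<forall>v. v \<noteq> 0 \<longrightarrow> 0 < (\<Sum>j\<in>UNIV. \<Sum>k\<in>UNIV. A $ j $ k * v $ j * cnj (v $ k)))"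

text \<open>The Levi matrix of a quadratic form does not depend on the base point \<open>x\<close>.\<close>

definition strictly_psh_quadratic_form :: "(complex ^ 'n::finite \<Rightarrow> real) \<Rightarrow> bool" where
  "strictly_psh_quadratic_form \<Phi> \<longleftrightarrow>
     quadratic_form \<Phi> \<and> (\<forall>x. positive_definite (levi_matrix \<Phi> x))"

type_synonym 'n phase_space = "(complex ^ 'n) \<times> (complex ^ 'n)"

abbreviation pscale :: "complex \<Rightarrow> 'n::finite phase_space \<Rightarrow> 'n phase_space" where
  "pscale \<equiv> module_prod.scale (*s) (*s)"

text \<open>The complex bilinear product; the library's inner product on \<open>complex ^ 'n\<close> is real-valued.\<close>

definition cdot :: "complex ^ 'n::finite \<Rightarrow> complex ^ 'n \<Rightarrow> complex" where
  "cdot a b = (\<Sum>j\<in>UNIV. a $ j * b $ j)"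

definition sigma :: "'n::finite phase_space \<Rightarrow> 'n phase_space \<Rightarrow> complex" where
  "sigma \<rho> \<tau> = cdot (snd \<rho>) (fst \<tau>) - cdot (fst \<rho>) (snd \<tau>)"

definition complex_linear_canonical :: "('n::finite phase_space \<Rightarrow> 'n phase_space) \<Rightarrow> bool" where
  "complex_linear_canonical \<kappa> \<longleftrightarrow>
     Vector_Spaces.linear pscale pscale \<kappa> \<and> bij \<kappa> \<and>
     (\<forall>\<rho> \<tau>. sigma (\<kappa> \<rho>) (\<kappa> \<tau>) = sigma \<rho> \<tau>)"

definition Lambda :: "(complex ^ 'n::finite \<Rightarrow> real) \<Rightarrow> 'n phase_space set" where
  "Lambda \<Phi> = {(x, (2 / \<i>) *s holomorphic_gradient \<Phi> x) | x. True}"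

definition antilinear :: "('n::finite phase_space \<Rightarrow> 'n phase_space) \<Rightarrow> bool" where
  "antilinear f \<longleftrightarrow>
     (\<forall>\<rho> \<tau>. f (\<rho> + \<tau>) = f \<rho> + f \<tau>) \<and> (\<forall>c \<rho>. f (pscale c \<rho>) = pscale (cnj c) (f \<rho>))"

text \<open>
  For strictly plurisubharmonic \<open>\<Phi>\<close> the set \<open>Lambda \<Phi>\<close> is maximally totally real, so exactly one
  map satisfies the description; for other \<open>\<Phi>\<close> the value may be arbitrary.
\<close>

definition iota :: "(complex ^ 'n::finite \<Rightarrow> real) \<Rightarrow> 'n phase_space \<Rightarrow> 'n phase_space" where
  "iota \<Phi> = (THE \<iota>. antilinear \<iota> \<and> (\<forall>\<rho>. \<iota> (\<iota> \<rho>) = \<rho>) \<and> (\<forall>\<rho>\<in>Lambda \<Phi>. \<iota> \<rho> = \<rho>))"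

text \<open>
  Positivity relative to the pair \<open>(Lambda \<Phi>\<^sub>1, Lambda \<Phi>\<^sub>2)\<close>; the forms are passed in place of
  the subspaces.
\<close>

definition positive_relative ::
  "('n::finite phase_space \<Rightarrow> 'n phase_space) \<Rightarrow> (complex ^ 'n \<Rightarrow> real) \<Rightarrow> (complex ^ 'n \<Rightarrow> real) \<Rightarrow> bool"
where
  "positive_relative \<kappa> \<Phi>\<^sub>1 \<Phi>\<^sub>2 \<longleftrightarrow>
     (\<forall>\<rho>. 0 \<le> (1 / \<i>) * (sigma (\<kappa> \<rho>) (iota \<Phi>\<^sub>1 (\<kappa> \<rho>)) - sigma \<rho> (iota \<Phi>\<^sub>2 \<rho>)))"

end

theory Submission
  imports Defs
begin

text \<open>
  Put \<open>h\<^sub>\<Phi>(\<rho>) = \<sigma>(\<rho>, \<iota>\<^sub>\<Phi> \<rho>) / i\<close>. For \<open>\<rho> = a + i b\<close> with \<open>a\<close>, \<open>b\<close> in \<open>\<Lambda>\<^sub>\<Phi>\<close> this is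
  \<open>-2 \<sigma>(a, b)\<close>, which equals four times a value of the Levi form. Completing the square for the
  Levi form gives
  \<open>h\<^sub>\<Phi>(x, (2/i) g) = 4 min\<^sub>w (\<Phi>(x + w) + \<Phi>(i w) - Re (g \<cdot> (x + 2 w)))\<close>,
  so that \<open>h\<^sub>\<Phi>\<close> is monotone in \<open>\<Phi>\<close>. Since \<open>\<kappa>\<close> preserves \<open>\<sigma>\<close>, it transports the form of
  \<open>\<Phi>\<^sub>2\<close> to that of \<open>\<Phi>\<close> when \<open>\<kappa>(\<Lambda>\<^bsub>\<Phi>\<^sub>2\<^esub>) = \<Lambda>\<^sub>\<Phi>\<close>, and \<open>\<Phi> \<le> \<Phi>\<^sub>1\<close> yields positivity.
  Conversely, \<open>h\<close> of \<open>\<Phi>\<^sub>1\<close> is negative definite on the fibre \<open>x = 0\<close>, while positivity makes it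
  nonnegative on \<open>\<kappa>(\<Lambda>\<^bsub>\<Phi>\<^sub>2\<^esub>)\<close>; hence that image is a graph, and being Lagrangian for \<open>Im \<sigma>\<close> it is
  \<open>\<Lambda>\<^sub>\<Phi>\<close> for some \<open>\<Phi>\<close>. Negativity on the fibre also makes \<open>\<Phi>\<close> strictly plurisubharmonic, and
  \<open>w = 0\<close> in the formula gives \<open>\<Phi> \<le> \<Phi>\<^sub>1\<close>.
\<close>

section \<open>The complex bilinear product and real-linear algebra on complex vectors\<close>

lemma cdot_add_left: "cdot (a + b) c = cdot a c + cdot b c"
  and cdot_add_right: "cdot a (b + c) = cdot a b + cdot a c"
  and cdot_diff_left: "cdot (a - b) c = cdot a c - cdot b c"
  and cdot_scale_left: "cdot (k *s a) c = k * cdot a c"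
  and cdot_scale_right: "cdot a (k *s c) = k * cdot a c"
  and cdot_scaleR_left: "cdot (r *\<^sub>R a) c = r * cdot a c"
  and cdot_scaleR_right: "cdot a (r *\<^sub>R c) = r * cdot a c"
  by (simp_all add: cdot_def ring_distribs mult_ac sum.distrib sum_subtractf sum_distrib_left scaleR_conv_of_real[where 'a = complex])

lemma cdot_commute: "cdot a b = cdot b a"
  by (simp add: cdot_def mult.commute)

lemma cdot_axis: "cdot a (axis j 1) = a $ j"
  by (simp add: cdot_def axis_def if_distrib cong: if_cong)

lemma cdot_ext: "(\<And>v. cdot a v = cdot b v) \<Longrightarrow> a = b"
  by (metis cdot_axis vec_eq_iff)

text \<open>The real part of a complex linear functional determines it: testing at
  \<open>\<i> *s v\<close> recovers the imaginary part.\<close>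

lemma cdot_Re_ext:
  assumes "\<And>v. Re (cdot a v) = Re (cdot b v)"
  shows "a = b"
proof (rule cdot_ext)
  fix v
  show "cdot a v = cdot b v"
    using assms[of v] assms[of "\<i> *s v"] by (simp add: cdot_scale_right complex_eq_iff)
qed

lemma smult_scaleR: "c *s (r *\<^sub>R x) = r *\<^sub>R (c *s x)" for x :: "complex ^ 'n::finite"
  by (simp add: vec_eq_iff scaleR_conv_of_real[where 'a = complex])

lemma i_smult_i: "\<i> *s (\<i> *s x) = - x" for x :: "complex ^ 'n::finite"
  by (simp add: vec_eq_iff flip: mult.assoc)

lemma smult_2_over_i_cancel: "(2 / \<i>) *s x = (2 / \<i>) *s y \<longleftrightarrow> x = y" for x :: "complex ^ 'n::finite"
  by (subst vector_mul_lcancel) simp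

lemma linear_smult: "linear ((*s) (c::complex))" for c
  by (rule linearI) (simp_all add: vector_add_ldistrib smult_scaleR)

lemma real_basis_expansion:
  "v = (\<Sum>j\<in>UNIV. Re (v $ j) *\<^sub>R axis j 1 + Im (v $ j) *\<^sub>R axis j \<i>)" for v :: "complex ^ 'n::finite"
proof -
  have "(\<Sum>j\<in>UNIV. Re (v $ j) *\<^sub>R axis j (1::complex) + Im (v $ j) *\<^sub>R axis j \<i>) $ k = v $ k" for k
  proof -
    have "(\<Sum>j\<in>UNIV. Re (v $ j) *\<^sub>R axis j (1::complex) + Im (v $ j) *\<^sub>R axis j \<i>) $ k
      = (\<Sum>j\<in>UNIV. if j = k then v $ j else 0)"
      unfolding sum_component by (rule sum.cong) (simp_all add: axis_def complex_eq_iff)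
    then show ?thesis by simp
  qed
  then show ?thesis by (simp add: vec_eq_iff)
qed

text \<open>A real-linear \<open>f\<close> splits into a complex linear and an antilinear part. The
  right-hand sides are twice these parts at \<open>v\<close>, the left-hand sides their expansions
  in coordinates. This makes \<open>dz\<close> and \<open>dzbar\<close> coordinate-free.\<close>

lemma sum_dz_linear:
  fixes f :: "complex ^ 'n::finite \<Rightarrow> complex"
  assumes "linear f"
  shows "(\<Sum>j\<in>UNIV. (f (axis j 1) - \<i> * f (axis j \<i>)) * v $ j) = f v - \<i> * f (\<i> *s v)"
    and "(\<Sum>j\<in>UNIV. (f (axis j 1) + \<i> * f (axis j \<i>)) * cnj (v $ j)) = f v + \<i> * f (\<i> *s v)"
proof -
  interpret linear f by fact
  have expand: "f u = (\<Sum>j\<in>UNIV. Re (u $ j) * f (axis j 1) + Im (u $ j) * f (axis j \<i>))" for u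
    by (subst real_basis_expansion) (simp add: sum add scale scaleR_conv_of_real[where 'a = complex])
  show "(\<Sum>j\<in>UNIV. (f (axis j 1) - \<i> * f (axis j \<i>)) * v $ j) = f v - \<i> * f (\<i> *s v)"
    "(\<Sum>j\<in>UNIV. (f (axis j 1) + \<i> * f (axis j \<i>)) * cnj (v $ j)) = f v + \<i> * f (\<i> *s v)"
    unfolding expand[of v] expand[of "\<i> *s v"] sum_distrib_left sum_subtractf[symmetric] sum.distrib[symmetric]
    by (rule sum.cong; simp add: complex_eq_iff algebra_simps)+
qed

section \<open>Polarization, holomorphic gradient and Levi form of a quadratic form\<close>

definition polar :: "('a::real_vector \<Rightarrow> real) \<Rightarrow> 'a \<Rightarrow> 'a \<Rightarrow> real" where
  "polar \<Phi> x y = (\<Phi> (x + y) - \<Phi> x - \<Phi> y) / 2"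

lemma polar_commute: "polar \<Phi> x y = polar \<Phi> y x"
  by (simp add: polar_def add.commute)

lemma bilinear_polar:
  assumes "quadratic_form \<Phi>"
  shows "bilinear (polar \<Phi>)" "polar \<Phi> x x = \<Phi> x"
proof -
  obtain B where B: "bilinear B" and \<Phi>: "\<And>x. \<Phi> x = B x x"
    using assms unfolding quadratic_form_def by blast
  note simps = bilinear_ladd[OF B] bilinear_radd[OF B] bilinear_lmul[OF B] bilinear_rmul[OF B]
  have p: "polar \<Phi> x y = (B x y + B y x) / 2" for x y
    by (simp add: polar_def \<Phi> simps)
  show "bilinear (polar \<Phi>)"
    unfolding bilinear_def by (auto intro!: linearI simp: p simps field_simps)
  show "polar \<Phi> x x = \<Phi> x"
    by (simp add: p \<Phi>)
qed

text \<open>Adding the values at \<open>\<i> *s x\<close> and \<open>\<i> *s y\<close> cancels the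
  pluriharmonic part of \<Phi>. What remains is, on the diagonal, twice the Levi form
  (\<open>levi_matrix_form\<close>).\<close>

definition levi :: "(complex ^ 'n::finite \<Rightarrow> real) \<Rightarrow> complex ^ 'n \<Rightarrow> complex ^ 'n \<Rightarrow> real" where
  "levi \<Phi> x y = polar \<Phi> x y + polar \<Phi> (\<i> *s x) (\<i> *s y)"

context
  fixes \<Phi> :: "complex ^ 'n::finite \<Rightarrow> real"
  assumes quad: "quadratic_form \<Phi>"
begin

lemmas polar_simps =
  bilinear_ladd[OF bilinear_polar(1)[OF quad]] bilinear_radd[OF bilinear_polar(1)[OF quad]]
  bilinear_lsub[OF bilinear_polar(1)[OF quad]] bilinear_rsub[OF bilinear_polar(1)[OF quad]]
  bilinear_lneg[OF bilinear_polar(1)[OF quad]] bilinear_rneg[OF bilinear_polar(1)[OF quad]]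
  bilinear_lmul[OF bilinear_polar(1)[OF quad]] bilinear_rmul[OF bilinear_polar(1)[OF quad]]

lemma linear_of_real_polar:
  "linear (\<lambda>v. complex_of_real (polar \<Phi> x v))" "linear (\<lambda>v. complex_of_real (polar \<Phi> v x))"
  by (auto intro!: linearI simp: polar_simps scaleR_conv_of_real[where 'a = complex])

lemma quadratic_form_has_derivative:
  "((\<lambda>y. complex_of_real (\<Phi> y)) has_derivative (\<lambda>v. complex_of_real (2 * polar \<Phi> x v))) (at x)"
proof -
  have "bounded_bilinear (polar \<Phi>)"
    using bilinear_polar(1)[OF quad] by (simp add: bilinear_conv_bounded_bilinear)
  from bounded_bilinear.FDERIV[OF this has_derivative_ident has_derivative_ident]
  have "((\<lambda>y. polar \<Phi> y y) has_derivative (\<lambda>v. 2 * polar \<Phi> x v)) (at x)"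
    by (rule has_derivative_eq_rhs) (simp add: polar_commute[of \<Phi> _ x])
  then show ?thesis
    by (intro has_derivative_of_real) (simp add: bilinear_polar(2)[OF quad])
qed

lemma frechet_quadratic_form:
  "frechet_derivative (\<lambda>y. complex_of_real (\<Phi> y)) (at x) v = 2 * polar \<Phi> x v"
  using frechet_derivative_at[OF quadratic_form_has_derivative, of x] by (simp add: fun_eq_iff)

text \<open>The derivative of \<Phi> at \<open>x\<close> is \<open>2 * polar \<Phi> x\<close>;
  pairing with the gradient takes its complex linear part.\<close>

lemma cdot_holomorphic_gradient:
  "cdot (holomorphic_gradient \<Phi> x) v = Complex (polar \<Phi> x v) (- polar \<Phi> x (\<i> *s v))"
proof -
  have "cdot (holomorphic_gradient \<Phi> x) v =
      (\<Sum>j\<in>UNIV. (polar \<Phi> x (axis j 1) - \<i> * polar \<Phi> x (axis j \<i>)) * v $ j)"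
    unfolding cdot_def holomorphic_gradient_def dz_def frechet_quadratic_form
    by (intro sum.cong) (simp_all add: field_simps)
  also have "\<dots> = polar \<Phi> x v - \<i> * polar \<Phi> x (\<i> *s v)"
    by (rule sum_dz_linear(1)[OF linear_of_real_polar(1)])
  finally show ?thesis by (simp add: complex_eq_iff)
qed

lemma linear_holomorphic_gradient: "linear (holomorphic_gradient \<Phi>)"
  by (rule linearI; rule cdot_ext)
    (simp_all add: cdot_add_left cdot_scaleR_left cdot_holomorphic_gradient polar_simps complex_eq_iff)

text \<open>Each \<open>dzbar k\<close> of \<Phi> is real-linear in the base point, hence its own
  derivative. Summing over \<open>j\<close> takes twice the complex linear part in \<open>v\<close>,
  summing over \<open>k\<close> twice the antilinear part of \<open>polar\<close>; the cross terms
  in \<open>v\<close> and \<open>\<i> *s v\<close> cancel by symmetry.\<close>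

lemma levi_matrix_form:
  "(\<Sum>j\<in>UNIV. \<Sum>k\<in>UNIV. levi_matrix \<Phi> x $ j $ k * v $ j * cnj (v $ k)) = levi \<Phi> v v / 2"
proof -
  define D where "D k y = complex_of_real (polar \<Phi> y (axis k 1)) + \<i> * polar \<Phi> y (axis k \<i>)" for k y
  have linD: "linear (D k)" for k
    unfolding D_def by (auto intro!: linearI simp: polar_simps scaleR_conv_of_real[where 'a = complex] algebra_simps)
  have dzbar: "dzbar k (\<lambda>y. complex_of_real (\<Phi> y)) = D k" for k
    by (simp add: fun_eq_iff dzbar_def frechet_quadratic_form D_def field_simps)
  have "frechet_derivative (D k) (at x) = D k" for k
    using linear_imp_has_derivative[OF linD] by (metis frechet_derivative_at)
  then have "(\<Sum>j\<in>UNIV. \<Sum>k\<in>UNIV. levi_matrix \<Phi> x $ j $ k * v $ j * cnj (v $ k))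
    = (\<Sum>j\<in>UNIV. \<Sum>k\<in>UNIV. (D k (axis j 1) - \<i> * D k (axis j \<i>)) * v $ j * cnj (v $ k) / 2)"
    by (simp add: levi_matrix_def dzbar dz_def)
  also have "\<dots> = (\<Sum>k\<in>UNIV. (\<Sum>j\<in>UNIV. (D k (axis j 1) - \<i> * D k (axis j \<i>)) * v $ j) * cnj (v $ k) / 2)"
    by (subst sum.swap) (simp add: sum_distrib_right sum_divide_distrib)
  also have "\<dots> = ((\<Sum>k\<in>UNIV. D k v * cnj (v $ k)) - \<i> * (\<Sum>k\<in>UNIV. D k (\<i> *s v) * cnj (v $ k))) / 2"
    unfolding sum_dz_linear(1)[OF linD]
    by (simp add: sum_distrib_left sum_subtractf[symmetric] sum_divide_distrib left_diff_distrib mult.assoc)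
  also have "\<dots> = levi \<Phi> v v / 2"
    unfolding D_def sum_dz_linear(2)[OF linear_of_real_polar(1)]
    by (simp add: levi_def i_smult_i polar_simps polar_commute[of \<Phi> v "\<i> *s v"] complex_eq_iff)
  finally show ?thesis .
qed

lemma strictly_psh_iff_levi:
  "strictly_psh_quadratic_form \<Phi> \<longleftrightarrow> (\<forall>v. v \<noteq> 0 \<longrightarrow> 0 < levi \<Phi> v v)"
  by (simp add: strictly_psh_quadratic_form_def quad positive_definite_def levi_matrix_form less_complex_def)

lemma levi_self: "levi \<Phi> v v = \<Phi> v + \<Phi> (\<i> *s v)"
  by (simp add: levi_def bilinear_polar(2)[OF quad])

lemma levi_simps:
  "levi \<Phi> (x + y) z = levi \<Phi> x z + levi \<Phi> y z" "levi \<Phi> x (y + z) = levi \<Phi> x y + levi \<Phi> x z"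
  "levi \<Phi> (x - y) z = levi \<Phi> x z - levi \<Phi> y z" "levi \<Phi> x (y - z) = levi \<Phi> x y - levi \<Phi> x z"
  "levi \<Phi> (- x) y = - levi \<Phi> x y" "levi \<Phi> x (- y) = - levi \<Phi> x y"
  "levi \<Phi> (r *\<^sub>R x) y = r * levi \<Phi> x y" "levi \<Phi> x (r *\<^sub>R y) = r * levi \<Phi> x y"
  by (simp_all add: levi_def polar_simps vector_add_ldistrib vector_ssub_ldistrib smult_scaleR
      linear_neg[OF linear_smult] algebra_simps)

lemma levi_i: "levi \<Phi> (\<i> *s x) (\<i> *s y) = levi \<Phi> x y" "levi \<Phi> (\<i> *s x) y = - levi \<Phi> x (\<i> *s y)"
  by (simp_all add: levi_def i_smult_i polar_simps)

lemma levi_commute: "levi \<Phi> x y = levi \<Phi> y x"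
  by (simp add: levi_def polar_commute[of \<Phi> x] polar_commute[of \<Phi> "\<i> *s x"])

text \<open>The combination on the left kills the complex linear part of the gradient, so only the
  Levi form survives. Taking \<open>v = z\<close> gives imaginary part
  \<open>levi \<Phi> z z\<close>, which makes the combination injective in \<open>z\<close> when
  \<Phi> is strictly plurisubharmonic.\<close>

lemma cdot_antilinear_part:
  "cdot (\<i> *s holomorphic_gradient \<Phi> z - holomorphic_gradient \<Phi> (\<i> *s z)) v
    = Complex (levi \<Phi> z (\<i> *s v)) (levi \<Phi> z v)"
  by (simp add: cdot_diff_left cdot_scale_left cdot_holomorphic_gradient levi_def i_smult_i polar_simps
      complex_eq_iff)

end

section \<open>The symplectic form on the graph of the gradient\<close>

lemma pscale_eq: "pscale c \<rho> = (c *s fst \<rho>, c *s snd \<rho>)" for \<rho> :: "'n::finite phase_space"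
proof -
  interpret module_prod "(*s) :: complex \<Rightarrow> complex ^ 'n \<Rightarrow> _" "(*s) :: complex \<Rightarrow> complex ^ 'n \<Rightarrow> _"
    by unfold_locales
  show ?thesis by (simp add: scale_def)
qed

lemma sigma_add_left: "sigma (a + b) c = sigma a c + sigma b c"
  and sigma_add_right: "sigma a (b + c) = sigma a b + sigma a c"
  and sigma_scale_left: "sigma (pscale k a) c = k * sigma a c"
  and sigma_scale_right: "sigma a (pscale k c) = k * sigma a c"
  by (simp_all add: sigma_def pscale_eq cdot_add_left cdot_add_right cdot_scale_left cdot_scale_right
      algebra_simps)

lemma sigma_commute: "sigma a b = - sigma b a"
  by (simp add: sigma_def cdot_commute)

definition graph_point :: "(complex ^ 'n::finite \<Rightarrow> real) \<Rightarrow> complex ^ 'n \<Rightarrow> 'n phase_space" where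
  "graph_point \<Phi> x = (x, (2 / \<i>) *s holomorphic_gradient \<Phi> x)"

lemma Lambda_eq_range: "Lambda \<Phi> = range (graph_point \<Phi>)"
  by (auto simp: Lambda_def graph_point_def)

lemma linear_graph_point:
  assumes "quadratic_form \<Phi>"
  shows "linear (graph_point \<Phi>)"
proof -
  interpret linear "holomorphic_gradient \<Phi>" using assms by (rule linear_holomorphic_gradient)
  show ?thesis
    by (rule linearI) (simp_all add: graph_point_def add scale vector_add_ldistrib smult_scaleR)
qed

text \<open>That the value is real means that \<open>Lambda \<Phi>\<close> is isotropic for the
  imaginary part of \<open>sigma\<close>.\<close>

lemma sigma_graph_point:
  assumes "quadratic_form \<Phi>"
  shows "sigma (graph_point \<Phi> a) (graph_point \<Phi> b) = complex_of_real (- 2 * levi \<Phi> a (\<i> *s b))"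
proof -
  have "sigma (graph_point \<Phi> a) (graph_point \<Phi> b) =
      (2 / \<i>) * (cdot (holomorphic_gradient \<Phi> a) b - cdot (holomorphic_gradient \<Phi> b) a)"
    unfolding sigma_def graph_point_def fst_conv snd_conv cdot_scale_left cdot_scale_right cdot_commute[of a]
    by (simp only: right_diff_distrib)
  then show ?thesis
    by (simp add: cdot_holomorphic_gradient[OF assms] levi_def i_smult_i polar_simps[OF assms]
        polar_commute[of \<Phi> b] complex_eq_iff)
qed

lemma sigma_conjugate_pair:
  "sigma (a + pscale \<i> b) (a - pscale \<i> b) = - 2 * \<i> * sigma a b"
proof -
  have conj: "a - pscale \<i> b = a + pscale (- \<i>) b"
    by (simp add: pscale_eq prod_eq_iff vec_eq_iff)
  have "sigma a a = 0" "sigma b b = 0"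
    using sigma_commute[of a a] sigma_commute[of b b] by auto
  then show ?thesis
    unfolding conj sigma_add_left sigma_add_right sigma_scale_left sigma_scale_right
    by (simp add: sigma_commute[of b a])
qed

section \<open>Total reality of \<open>Lambda \<Phi>\<close> and the antilinear involution\<close>

context
  fixes \<Phi> :: "complex ^ 'n::finite \<Rightarrow> real"
  assumes spsh: "strictly_psh_quadratic_form \<Phi>"
begin

lemma strictly_psh_imp_quadratic_form: "quadratic_form \<Phi>"
  using spsh by (simp add: strictly_psh_quadratic_form_def)

lemma levi_nonneg: "0 \<le> levi \<Phi> v v"
proof (cases "v = 0")
  case True
  then show ?thesis using levi_simps(7)[OF strictly_psh_imp_quadratic_form, of 0 v v] by simp
next
  case False
  then show ?thesis using spsh strictly_psh_iff_levi[OF strictly_psh_imp_quadratic_form] by fastforce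
qed

lemma levi_eq_0: "levi \<Phi> v v = 0 \<Longrightarrow> v = 0"
  using spsh strictly_psh_iff_levi[OF strictly_psh_imp_quadratic_form] by fastforce

text \<open>Eliminating \<open>a\<close> by first components leaves one real-linear equation for
  \<open>b\<close>. Its operator is injective by positivity of the Levi form, hence surjective by
  finite dimension.\<close>

lemma graph_decomposition_exists:
  obtains a b where "\<rho> = graph_point \<Phi> a + pscale \<i> (graph_point \<Phi> b)"
proof -
  interpret G: linear "holomorphic_gradient \<Phi>" by (rule linear_holomorphic_gradient[OF strictly_psh_imp_quadratic_form])
  let ?T = "\<lambda>z. \<i> *s holomorphic_gradient \<Phi> z - holomorphic_gradient \<Phi> (\<i> *s z)"
  have "linear ?T"
    by (rule linearI) (simp_all add: G.add G.scale vector_add_ldistrib smult_scaleR algebra_simps)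
  moreover have "inj ?T"
  proof (subst linear_injective_0[OF \<open>linear ?T\<close>], intro allI impI)
    fix z assume "?T z = 0"
    then have "Complex (levi \<Phi> z (\<i> *s z)) (levi \<Phi> z z) = 0"
      using cdot_antilinear_part[OF strictly_psh_imp_quadratic_form, of z z] by (simp add: cdot_def)
    then show "z = 0" by (simp add: complex_eq_iff levi_eq_0)
  qed
  ultimately have "surj ?T" by (rule linear_inj_imp_surj)
  \<comment> \<open>With \<open>a = fst \<rho> - \<i> *s z\<close> and \<open>b = z\<close>, this is
    the equation of second components, multiplied by \<open>\<i> / 2\<close>.\<close>
  then obtain z where z: "(\<i> / 2) *s snd \<rho> - holomorphic_gradient \<Phi> (fst \<rho>) = ?T z"
    by (rule surjE)
  have "(2 / \<i>) *s ((\<i> / 2) *s snd \<rho>) = snd \<rho>"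
    by (simp add: vec_eq_iff)
  moreover have "(\<i> / 2) *s snd \<rho> = ?T z + holomorphic_gradient \<Phi> (fst \<rho>)"
    using z by (simp add: algebra_simps)
  ultimately have "snd \<rho> = (2 / \<i>) *s (?T z + holomorphic_gradient \<Phi> (fst \<rho>))"
    by simp
  then have "\<rho> = graph_point \<Phi> (fst \<rho> - \<i> *s z) + pscale \<i> (graph_point \<Phi> z)"
    by (simp add: graph_point_def pscale_eq prod_eq_iff G.diff vec_eq_iff field_simps)
  then show thesis by (rule that)
qed

text \<open>The difference \<open>b - d\<close> lies in the kernel of the operator inverted in
  \<open>graph_decomposition_exists\<close>.\<close>

lemma graph_decomposition_unique:
  assumes "graph_point \<Phi> a + pscale \<i> (graph_point \<Phi> b) = graph_point \<Phi> c + pscale \<i> (graph_point \<Phi> d)"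
  shows "a = c" "b = d"
proof -
  interpret G: linear "holomorphic_gradient \<Phi>" by (rule linear_holomorphic_gradient[OF strictly_psh_imp_quadratic_form])
  let ?z = "b - d"
  have ac: "a + \<i> *s b = c + \<i> *s d"
    and snds: "(2 / \<i>) *s holomorphic_gradient \<Phi> a + \<i> *s ((2 / \<i>) *s holomorphic_gradient \<Phi> b) =
      (2 / \<i>) *s holomorphic_gradient \<Phi> c + \<i> *s ((2 / \<i>) *s holomorphic_gradient \<Phi> d)"
    using assms by (simp_all add: graph_point_def pscale_eq)
  from ac have iz: "\<i> *s ?z = c - a"
    by (simp add: vector_ssub_ldistrib algebra_simps)
  from snds have "(2 / \<i>) *s (holomorphic_gradient \<Phi> a + \<i> *s holomorphic_gradient \<Phi> b) =
      (2 / \<i>) *s (holomorphic_gradient \<Phi> c + \<i> *s holomorphic_gradient \<Phi> d)"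
    by (simp add: vec_eq_iff algebra_simps)
  then have "\<i> *s holomorphic_gradient \<Phi> ?z - holomorphic_gradient \<Phi> (\<i> *s ?z) = 0"
    unfolding iz smult_2_over_i_cancel by (simp add: G.diff vector_ssub_ldistrib algebra_simps)
  then have "Complex (levi \<Phi> ?z (\<i> *s ?z)) (levi \<Phi> ?z ?z) = 0"
    using cdot_antilinear_part[OF strictly_psh_imp_quadratic_form, of ?z ?z] by (simp add: cdot_def)
  then show "b = d" by (simp add: complex_eq_iff) (use levi_eq_0[of ?z] in simp)
  with ac show "a = c" by simp
qed

text \<open>As \<open>iota\<close> is a definite description, existence and uniqueness must both be
  shown. Antilinearity forces the value of any candidate; conversely, flipping the sign of the
  second coordinate of the decomposition defines one.\<close>

lemma iota_graph_decomposition: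
  "iota \<Phi> (graph_point \<Phi> a + pscale \<i> (graph_point \<Phi> b)) = graph_point \<Phi> a - pscale \<i> (graph_point \<Phi> b)"
proof -
  interpret L: linear "graph_point \<Phi>" by (rule linear_graph_point[OF strictly_psh_imp_quadratic_form])
  let ?c = "\<lambda>a b. graph_point \<Phi> a + pscale \<i> (graph_point \<Phi> b)"
  let ?P = "\<lambda>f. antilinear f \<and> (\<forall>\<rho>. f (f \<rho>) = \<rho>) \<and> (\<forall>\<rho>\<in>Lambda \<Phi>. f \<rho> = \<rho>)"
  have forced: "f (?c a b) = graph_point \<Phi> a - pscale \<i> (graph_point \<Phi> b)" if "?P f" for f a b
  proof -
    have "f (?c a b) = f (graph_point \<Phi> a) + pscale (cnj \<i>) (f (graph_point \<Phi> b))"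
      using that unfolding antilinear_def by metis
    also have "\<dots> = graph_point \<Phi> a + pscale (- \<i>) (graph_point \<Phi> b)"
      using that by (simp add: Lambda_eq_range)
    finally show ?thesis by (simp add: pscale_eq prod_eq_iff vec_eq_iff)
  qed
  have "\<forall>\<rho>. \<exists>a b. \<rho> = ?c a b"
    using graph_decomposition_exists by blast
  then obtain Y Z where YZ: "\<And>\<rho>. \<rho> = ?c (Y \<rho>) (Z \<rho>)"
    unfolding choice_iff by blast
  have YZ_c: "Y (?c a b) = a" "Z (?c a b) = b" for a b
    using graph_decomposition_unique[OF YZ[of "?c a b"]] by simp_all
  define f where "f \<rho> = ?c (Y \<rho>) (- Z \<rho>)" for \<rho>
  have f_c: "f \<rho> = ?c a (- b)" if "\<rho> = ?c a b" for \<rho> a b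
    unfolding that f_def YZ_c ..
  have "?P f"
    unfolding antilinear_def
  proof (intro conjI allI ballI)
    fix \<rho> \<tau>
    have "\<rho> + \<tau> = ?c (Y \<rho>) (Z \<rho>) + ?c (Y \<tau>) (Z \<tau>)"
      by (rule arg_cong2[OF YZ YZ])
    also have "\<dots> = ?c (Y \<rho> + Y \<tau>) (Z \<rho> + Z \<tau>)"
      by (simp add: L.add pscale_eq prod_eq_iff vec_eq_iff algebra_simps)
    finally have "f (\<rho> + \<tau>) = ?c (Y \<rho> + Y \<tau>) (- (Z \<rho> + Z \<tau>))"
      by (rule f_c)
    then show "f (\<rho> + \<tau>) = f \<rho> + f \<tau>"
      by (simp add: f_def L.add L.diff L.neg pscale_eq prod_eq_iff vec_eq_iff algebra_simps)
  next
    fix k \<rho>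
    \<comment> \<open>The coordinates of \<open>k\<close> times a vector with coordinates
      \<open>Y \<rho>\<close> and \<open>Z \<rho>\<close>, as for a product of complex
      numbers.\<close>
    let ?Y = "Re k *\<^sub>R Y \<rho> - Im k *\<^sub>R Z \<rho>" and ?Z = "Im k *\<^sub>R Y \<rho> + Re k *\<^sub>R Z \<rho>"
    have "pscale k \<rho> = pscale k (?c (Y \<rho>) (Z \<rho>))"
      by (rule arg_cong[OF YZ])
    also have "\<dots> = ?c ?Y ?Z"
      by (simp add: L.add L.diff L.scale pscale_eq prod_eq_iff vec_eq_iff complex_eq_iff algebra_simps)
    finally have "f (pscale k \<rho>) = ?c ?Y (- ?Z)"
      by (rule f_c)
    then show "f (pscale k \<rho>) = pscale (cnj k) (f \<rho>)"
      by (simp add: f_def L.add L.diff L.neg L.scale pscale_eq prod_eq_iff vec_eq_iff complex_eq_iff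
          algebra_simps)
  next
    fix \<rho> show "f (f \<rho>) = \<rho>"
      using f_c[OF f_def] YZ[of \<rho>] by simp
  next
    fix \<rho> assume "\<rho> \<in> Lambda \<Phi>"
    then obtain a where "\<rho> = ?c a 0"
      by (auto simp: Lambda_eq_range L.zero pscale_eq simp flip: zero_prod_def)
    then show "f \<rho> = \<rho>" using f_c[of \<rho> a 0] by simp
  qed
  moreover have "g = f" if "?P g" for g
  proof
    fix \<rho>
    show "g \<rho> = f \<rho>"
      using forced[OF that, of "Y \<rho>" "Z \<rho>"] forced[OF \<open>?P f\<close>, of "Y \<rho>" "Z \<rho>"]
      unfolding YZ[symmetric] by simp
  qed
  ultimately have "?P (iota \<Phi>)"
    unfolding iota_def by (rule theI)
  then show ?thesis by (rule forced)
qed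

end

text \<open>Symmetry is the integrability condition: it makes \<open>Re (cdot (g x) y)\<close> the
  polarization of \<Phi>. This later recovers \<Phi> from a Lagrangian graph.\<close>

lemma quadratic_form_of_symmetric_gradient:
  fixes g :: "complex ^ 'n::finite \<Rightarrow> complex ^ 'n"
  assumes "linear g" and sym: "\<And>x y. Re (cdot (g x) y) = Re (cdot (g y) x)"
  defines "\<Phi> \<equiv> \<lambda>x. Re (cdot (g x) x)"
  shows "quadratic_form \<Phi>" "holomorphic_gradient \<Phi> = g"
proof -
  interpret linear g by fact
  have "bilinear (\<lambda>x y. Re (cdot (g x) y))"
    unfolding bilinear_def
    by (auto intro!: linearI simp: add scale cdot_add_left cdot_add_right cdot_scaleR_left cdot_scaleR_right)
  then show quad: "quadratic_form \<Phi>"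
    unfolding quadratic_form_def \<Phi>_def by blast
  have "polar \<Phi> x y = Re (cdot (g x) y)" for x y
    using sym[of x y] by (simp add: polar_def \<Phi>_def add cdot_add_left cdot_add_right)
  then show "holomorphic_gradient \<Phi> = g"
    by (intro ext cdot_Re_ext) (simp add: cdot_holomorphic_gradient[OF quad])
qed

section \<open>The Hermitian form of the involution and its variational formula\<close>

definition hermitian_form :: "(complex ^ 'n::finite \<Rightarrow> real) \<Rightarrow> 'n phase_space \<Rightarrow> real" where
  "hermitian_form \<Phi> \<rho> = Re (sigma \<rho> (iota \<Phi> \<rho>) / \<i>)"

context
  fixes \<Phi> :: "complex ^ 'n::finite \<Rightarrow> real"
  assumes spsh: "strictly_psh_quadratic_form \<Phi>"
begin

lemma sigma_iota_decomposition:
  "sigma (graph_point \<Phi> a + pscale \<i> (graph_point \<Phi> b)) (iota \<Phi> (graph_point \<Phi> a + pscale \<i> (graph_point \<Phi> b)))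
    = \<i> * complex_of_real (4 * levi \<Phi> a (\<i> *s b))"
  unfolding iota_graph_decomposition[OF spsh] sigma_conjugate_pair sigma_graph_point[OF strictly_psh_imp_quadratic_form[OF spsh]]
  by simp

text \<open>Taking the real part in \<open>hermitian_form\<close> loses nothing, so positivity
  becomes an inequality between real numbers.\<close>

lemma sigma_iota: "sigma \<rho> (iota \<Phi> \<rho>) = \<i> * complex_of_real (hermitian_form \<Phi> \<rho>)"
proof -
  obtain a b where "\<rho> = graph_point \<Phi> a + pscale \<i> (graph_point \<Phi> b)"
    using graph_decomposition_exists[OF spsh] .
  then show ?thesis by (simp add: hermitian_form_def sigma_iota_decomposition)
qed

lemma hermitian_form_decomposition:
  "hermitian_form \<Phi> (graph_point \<Phi> a + pscale \<i> (graph_point \<Phi> b)) = 4 * levi \<Phi> a (\<i> *s b)"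
  by (simp add: hermitian_form_def sigma_iota_decomposition)

text \<open>Negative definiteness on the fibre: a vanishing first component forces
  \<open>a = - (\<i> *s b)\<close>, and the form becomes
  \<open>- 4 * levi \<Phi> b b\<close>.\<close>

lemma hermitian_form_vertical:
  assumes "fst \<rho> = 0" "0 \<le> hermitian_form \<Phi> \<rho>"
  shows "\<rho> = 0"
proof -
  note q = strictly_psh_imp_quadratic_form[OF spsh]
  obtain a b where \<rho>: "\<rho> = graph_point \<Phi> a + pscale \<i> (graph_point \<Phi> b)"
    using graph_decomposition_exists[OF spsh] .
  with assms(1) have a: "a = - (\<i> *s b)"
    by (simp add: graph_point_def pscale_eq eq_neg_iff_add_eq_0)
  have "levi \<Phi> b b \<le> 0"
    using assms(2) unfolding \<rho> hermitian_form_decomposition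
    by (simp add: a levi_simps[OF q] levi_i(1)[OF q])
  then have "b = 0"
    by (intro levi_eq_0[OF spsh] antisym levi_nonneg[OF spsh])
  then show ?thesis
    by (simp add: \<rho> a linear_0[OF linear_graph_point[OF q]] pscale_eq zero_prod_def)
qed

lemma hermitian_form_graph_point: "hermitian_form \<Phi> (graph_point \<Phi> x) = 0"
proof -
  note q = strictly_psh_imp_quadratic_form[OF spsh]
  have "graph_point \<Phi> x = graph_point \<Phi> x + pscale \<i> (graph_point \<Phi> 0)"
    by (simp add: linear_0[OF linear_graph_point[OF q]] pscale_eq zero_prod_def[symmetric])
  then show ?thesis
    using hermitian_form_decomposition[of x 0] levi_simps(8)[OF q, of x 0 0] by simp
qed

text \<open>The right-hand side exceeds the Hermitian form by a Levi square in
  \<open>\<i> *s w - z\<close>, where \<open>z\<close> is the second coordinate of the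
  point.\<close>

lemma hermitian_form_variational:
  shows hermitian_form_le:
      "hermitian_form \<Phi> (x, (2 / \<i>) *s g) \<le> 4 * (\<Phi> (x + w) + \<Phi> (\<i> *s w) - Re (cdot g (x + 2 *\<^sub>R w)))"
    and hermitian_form_attained:
      "\<exists>w. hermitian_form \<Phi> (x, (2 / \<i>) *s g) = 4 * (\<Phi> (x + w) + \<Phi> (\<i> *s w) - Re (cdot g (x + 2 *\<^sub>R w)))"
proof -
  note q = strictly_psh_imp_quadratic_form[OF spsh]
  interpret G: linear "holomorphic_gradient \<Phi>" by (rule linear_holomorphic_gradient[OF q])
  obtain a z where az: "(x, (2 / \<i>) *s g) = graph_point \<Phi> a + pscale \<i> (graph_point \<Phi> z)"
    using graph_decomposition_exists[OF spsh] .
  then have x: "x = a + \<i> *s z"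
    and "(2 / \<i>) *s g = (2 / \<i>) *s (holomorphic_gradient \<Phi> a + \<i> *s holomorphic_gradient \<Phi> z)"
    by (simp_all add: graph_point_def pscale_eq vec_eq_iff algebra_simps)
  then have "g = holomorphic_gradient \<Phi> a + \<i> *s holomorphic_gradient \<Phi> z"
    unfolding smult_2_over_i_cancel by blast
  also have "\<dots> = holomorphic_gradient \<Phi> x + (\<i> *s holomorphic_gradient \<Phi> z - holomorphic_gradient \<Phi> (\<i> *s z))"
    by (simp add: x G.add)
  finally have Re_g: "Re (cdot g v) = polar \<Phi> x v + levi \<Phi> z (\<i> *s v)" for v
    by (simp add: cdot_add_left cdot_antilinear_part[OF q] cdot_holomorphic_gradient[OF q])
  have h: "hermitian_form \<Phi> (x, (2 / \<i>) *s g) = 4 * (levi \<Phi> x (\<i> *s z) - levi \<Phi> z z)"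
    unfolding az hermitian_form_decomposition by (simp add: x levi_simps[OF q] levi_i[OF q])
  have square: "4 * (\<Phi> (x + w) + \<Phi> (\<i> *s w) - Re (cdot g (x + 2 *\<^sub>R w)))
      = hermitian_form \<Phi> (x, (2 / \<i>) *s g) + 4 * levi \<Phi> (\<i> *s w - z) (\<i> *s w - z)" for w
  proof -
    have "\<Phi> (x + w) = \<Phi> x + 2 * polar \<Phi> x w + \<Phi> w"
      by (simp add: polar_def field_simps)
    moreover have "levi \<Phi> (\<i> *s w - z) (\<i> *s w - z) = levi \<Phi> w w - 2 * levi \<Phi> z (\<i> *s w) + levi \<Phi> z z"
      using levi_commute[OF q, of z "\<i> *s w"] by (simp add: levi_simps[OF q] levi_i(1)[OF q])
    moreover have "levi \<Phi> z (\<i> *s x) = - levi \<Phi> x (\<i> *s z)"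
      by (metis levi_i(2)[OF q] levi_commute[OF q])
    ultimately show ?thesis
      unfolding h Re_g
      by (simp add: vector_add_ldistrib smult_scaleR levi_simps[OF q] polar_simps[OF q]
          bilinear_polar(2)[OF q] levi_self[OF q])
  qed
  show "hermitian_form \<Phi> (x, (2 / \<i>) *s g) \<le> 4 * (\<Phi> (x + w) + \<Phi> (\<i> *s w) - Re (cdot g (x + 2 *\<^sub>R w)))"
    using square[of w] levi_nonneg[OF spsh] by simp
  \<comment> \<open>The minimizer solves \<open>\<i> *s w = z\<close>, so
    \<open>w = \<i> *s (- z)\<close>.\<close>
  have "\<i> *s (\<i> *s (- z)) - z = 0"
    by (simp add: i_smult_i)
  then have "hermitian_form \<Phi> (x, (2 / \<i>) *s g) =
      4 * (\<Phi> (x + \<i> *s (- z)) + \<Phi> (\<i> *s (\<i> *s (- z))) - Re (cdot g (x + 2 *\<^sub>R (\<i> *s (- z)))))"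
    using square[of "\<i> *s (- z)"] levi_simps(7)[OF q, of 0 0 0] by simp
  then show "\<exists>w. hermitian_form \<Phi> (x, (2 / \<i>) *s g) = 4 * (\<Phi> (x + w) + \<Phi> (\<i> *s w) - Re (cdot g (x + 2 *\<^sub>R w)))"
    by blast
qed

end

text \<open>Evaluate both variational expressions at the minimizer for \<Psi>: it attains the value
  for \<Psi> and bounds that for \<Phi> from above.\<close>

lemma hermitian_form_mono:
  assumes "strictly_psh_quadratic_form \<Phi>" "strictly_psh_quadratic_form \<Psi>" "\<And>x. \<Phi> x \<le> \<Psi> x"
  shows "hermitian_form \<Phi> \<rho> \<le> hermitian_form \<Psi> \<rho>"
proof -
  obtain x g where \<rho>: "\<rho> = (x, (2 / \<i>) *s g)"
  proof
    show "\<rho> = (fst \<rho>, (2 / \<i>) *s ((\<i> / 2) *s snd \<rho>))"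
      by (simp add: prod_eq_iff vec_eq_iff)
  qed
  obtain w where "hermitian_form \<Psi> \<rho> = 4 * (\<Psi> (x + w) + \<Psi> (\<i> *s w) - Re (cdot g (x + 2 *\<^sub>R w)))"
    using hermitian_form_attained[OF assms(2)] unfolding \<rho> by blast
  moreover have "hermitian_form \<Phi> \<rho> \<le> 4 * (\<Phi> (x + w) + \<Phi> (\<i> *s w) - Re (cdot g (x + 2 *\<^sub>R w)))"
    unfolding \<rho> by (rule hermitian_form_le[OF assms(1)])
  ultimately show ?thesis
    using assms(3)[of "x + w"] assms(3)[of "\<i> *s w"] by argo
qed

lemma positive_relative_iff:
  assumes "strictly_psh_quadratic_form \<Phi>\<^sub>1" "strictly_psh_quadratic_form \<Phi>\<^sub>2"
  shows "positive_relative \<kappa> \<Phi>\<^sub>1 \<Phi>\<^sub>2 \<longleftrightarrow> (\<forall>\<rho>. hermitian_form \<Phi>\<^sub>2 \<rho> \<le> hermitian_form \<Phi>\<^sub>1 (\<kappa> \<rho>))"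
  by (simp add: positive_relative_def sigma_iota[OF assms(1)] sigma_iota[OF assms(2)] less_eq_complex_def
      right_diff_distrib)

section \<open>Canonical transformations and the two implications\<close>

locale canonical_transformation =
  fixes \<kappa> :: "'n::finite phase_space \<Rightarrow> 'n phase_space"
  assumes canonical: "complex_linear_canonical \<kappa>"
begin

lemma sigma_image: "sigma (\<kappa> \<rho>) (\<kappa> \<tau>) = sigma \<rho> \<tau>"
  using canonical unfolding complex_linear_canonical_def by blast

lemma inj: "inj \<kappa>"
  using canonical by (simp add: complex_linear_canonical_def bij_is_inj)

lemma image_add: "\<kappa> (\<rho> + \<tau>) = \<kappa> \<rho> + \<kappa> \<tau>"
  and image_scale: "\<kappa> (pscale c \<rho>) = pscale c (\<kappa> \<rho>)"
proof -
  interpret Vector_Spaces.linear pscale pscale \<kappa>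
    using canonical by (simp add: complex_linear_canonical_def)
  show "\<kappa> (\<rho> + \<tau>) = \<kappa> \<rho> + \<kappa> \<tau>" "\<kappa> (pscale c \<rho>) = pscale c (\<kappa> \<rho>)"
    by (rule add scale)+
qed

lemma real_linear: "linear \<kappa>"
proof (rule linearI)
  fix r \<rho>
  have "r *\<^sub>R \<tau> = pscale (complex_of_real r) \<tau>" for \<tau> :: "'n phase_space"
    by (simp add: pscale_eq prod_eq_iff vec_eq_iff scaleR_conv_of_real[where 'a = complex])
  then show "\<kappa> (r *\<^sub>R \<rho>) = r *\<^sub>R \<kappa> \<rho>" by (simp add: image_scale)
qed (rule image_add)

text \<open>Both sides are read off from \<open>sigma\<close> on the graphs, which \<kappa>
  preserves.\<close>

lemma levi_image:
  assumes "quadratic_form \<Phi>" "quadratic_form \<Psi>"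
    and "\<kappa> (graph_point \<Phi> a) = graph_point \<Psi> a'" "\<kappa> (graph_point \<Phi> b) = graph_point \<Psi> b'"
  shows "levi \<Phi> a (\<i> *s b) = levi \<Psi> a' (\<i> *s b')"
  using sigma_image[of "graph_point \<Phi> a" "graph_point \<Phi> b"]
  unfolding assms(3,4) sigma_graph_point[OF assms(1)] sigma_graph_point[OF assms(2)] of_real_eq_iff by simp

text \<open>By complex linearity \<kappa> carries the decomposition along
  \<open>Lambda \<Phi>\<^sub>2\<close> to the one along \<open>Lambda \<Phi>\<close>, so it matches
  the two Hermitian forms; monotonicity does the rest.\<close>

lemma positive_if_image:
  assumes "strictly_psh_quadratic_form \<Phi>\<^sub>1" "strictly_psh_quadratic_form \<Phi>\<^sub>2" "strictly_psh_quadratic_form \<Phi>"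
    and image: "\<kappa> ` Lambda \<Phi>\<^sub>2 = Lambda \<Phi>" and le: "\<And>x. \<Phi> x \<le> \<Phi>\<^sub>1 x"
  shows "positive_relative \<kappa> \<Phi>\<^sub>1 \<Phi>\<^sub>2"
  unfolding positive_relative_iff[OF assms(1,2)]
proof
  fix \<rho>
  obtain a b where \<rho>: "\<rho> = graph_point \<Phi>\<^sub>2 a + pscale \<i> (graph_point \<Phi>\<^sub>2 b)"
    using graph_decomposition_exists[OF assms(2)] .
  obtain a' b' where ab: "\<kappa> (graph_point \<Phi>\<^sub>2 a) = graph_point \<Phi> a'" "\<kappa> (graph_point \<Phi>\<^sub>2 b) = graph_point \<Phi> b'"
    using image unfolding Lambda_eq_range by (metis imageE imageI rangeI)
  have "hermitian_form \<Phi>\<^sub>2 \<rho> = hermitian_form \<Phi> (\<kappa> \<rho>)"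
    unfolding \<rho> image_add image_scale ab hermitian_form_decomposition[OF assms(2)]
      hermitian_form_decomposition[OF assms(3)] levi_image[OF strictly_psh_imp_quadratic_form[OF assms(2)] strictly_psh_imp_quadratic_form[OF assms(3)] ab] ..
  also have "\<dots> \<le> hermitian_form \<Phi>\<^sub>1 (\<kappa> \<rho>)"
    by (rule hermitian_form_mono[OF assms(3,1) le])
  finally show "hermitian_form \<Phi>\<^sub>2 \<rho> \<le> hermitian_form \<Phi>\<^sub>1 (\<kappa> \<rho>)" .
qed

lemma image_if_positive:
  assumes spsh1: "strictly_psh_quadratic_form \<Phi>\<^sub>1" and spsh2: "strictly_psh_quadratic_form \<Phi>\<^sub>2"
    and "positive_relative \<kappa> \<Phi>\<^sub>1 \<Phi>\<^sub>2"
  obtains \<Phi> where "strictly_psh_quadratic_form \<Phi>" "\<kappa> ` Lambda \<Phi>\<^sub>2 = Lambda \<Phi>" "\<And>x. \<Phi> x \<le> \<Phi>\<^sub>1 x"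
proof -
  have pos: "hermitian_form \<Phi>\<^sub>2 \<rho> \<le> hermitian_form \<Phi>\<^sub>1 (\<kappa> \<rho>)" for \<rho>
    using assms(3) positive_relative_iff[OF spsh1 spsh2] by blast
  have \<kappa>_eq_0: "\<kappa> \<rho> = 0 \<Longrightarrow> \<rho> = 0" for \<rho>
    using inj real_linear by (metis linear_injective_0)
  have graph_eq_0: "graph_point \<Psi> x = 0 \<Longrightarrow> x = 0" for \<Psi> and x :: "complex ^ 'n"
    by (simp add: graph_point_def zero_prod_def)
  let ?k = "\<lambda>x. \<kappa> (graph_point \<Phi>\<^sub>2 x)"
  have lin_k: "linear ?k"
    using linear_compose[OF linear_graph_point[OF strictly_psh_imp_quadratic_form[OF spsh2]] real_linear] by (simp add: o_def)
  define \<pi> where "\<pi> x = fst (?k x)" for x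
  have "linear \<pi>"
    unfolding \<pi>_def using linear_compose[OF lin_k linear_fst] by (simp add: o_def)
  moreover have "inj \<pi>"
  \<comment> \<open>A kernel vector gives a vertical image point. The form of
    \<open>\<Phi>\<^sub>2\<close> vanishes on its own graph, so that of
    \<open>\<Phi>\<^sub>1\<close> is nonnegative at this point, which is therefore zero.\<close>
  proof (subst linear_injective_0[OF \<open>linear \<pi>\<close>], intro allI impI)
    fix x assume "\<pi> x = 0"
    then have "?k x = 0"
      using pos[of "graph_point \<Phi>\<^sub>2 x"]
      by (intro hermitian_form_vertical[OF spsh1]) (simp_all add: \<pi>_def hermitian_form_graph_point[OF spsh2])
    then show "x = 0" using \<kappa>_eq_0 graph_eq_0 by blast
  qed
  ultimately have "surj \<pi>" by (rule linear_inj_imp_surj)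
  obtain \<theta> where "linear \<theta>" and \<theta>_\<pi>: "\<theta> (\<pi> x) = x" for x
    using linear_injective_left_inverse[OF \<open>linear \<pi>\<close> \<open>inj \<pi>\<close>] by (auto simp: o_def fun_eq_iff)
  have \<pi>_\<theta>: "\<pi> (\<theta> x) = x" for x
    using \<open>surj \<pi>\<close> \<theta>_\<pi> by (metis surjD)
  \<comment> \<open>The factor \<open>\<i> / 2\<close> inverts the \<open>2 / \<i>\<close> of
    \<open>Lambda\<close>, so \<open>g\<close> is the gradient that \<Phi> must have.\<close>
  define g where "g x = (\<i> / 2) *s snd (?k (\<theta> x))" for x
  have "linear g"
    unfolding g_def
    using linear_compose[OF linear_compose[OF linear_compose[OF \<open>linear \<theta>\<close> lin_k] linear_snd] linear_smult]
    by (simp add: o_def)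
  have k_\<theta>: "?k (\<theta> x) = (x, (2 / \<i>) *s g x)" for x
    using \<pi>_\<theta>[of x] by (simp add: g_def \<pi>_def prod_eq_iff vec_eq_iff)
  have sym: "Re (cdot (g x) y) = Re (cdot (g y) x)" for x y
  proof -
    have "sigma (?k (\<theta> x)) (?k (\<theta> y)) = (2 / \<i>) * (cdot (g x) y - cdot (g y) x)"
      unfolding k_\<theta> sigma_def fst_conv snd_conv cdot_scale_left cdot_scale_right cdot_commute[of x]
      by (simp only: right_diff_distrib)
    \<comment> \<open>\<open>sigma\<close> is real on \<open>Lambda \<Phi>\<^sub>2\<close>, hence on
      its image; division by \<open>\<i>\<close> turns this into a statement on real parts.\<close>
    then have "Im ((2 / \<i>) * (cdot (g x) y - cdot (g y) x)) = 0"
      by (metis sigma_image sigma_graph_point[OF strictly_psh_imp_quadratic_form[OF spsh2]] Im_complex_of_real)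
    then show ?thesis by simp
  qed
  define \<Phi> where "\<Phi> x = Re (cdot (g x) x)" for x
  have q: "quadratic_form \<Phi>" and grad: "holomorphic_gradient \<Phi> = g"
    using quadratic_form_of_symmetric_gradient[OF \<open>linear g\<close> sym] by (simp_all add: \<Phi>_def[abs_def])
  have k_graph: "?k (\<theta> x) = graph_point \<Phi> x" for x
    unfolding k_\<theta> graph_point_def[of \<Phi>] grad ..
  show thesis
  proof
    have "0 < levi \<Phi> z z" if "z \<noteq> 0" for z
    proof (rule ccontr)
      assume "\<not> 0 < levi \<Phi> z z"
      \<comment> \<open>Chosen so that the image of \<open>?\<rho>\<close> has first component
        \<open>- (\<i> *s z) + \<i> *s z = 0\<close>, while the form of
        \<open>\<Phi>\<^sub>2\<close> at \<open>?\<rho>\<close> is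
        \<open>- 4 * levi \<Phi> z z\<close>.\<close>
      define a b where "a = \<theta> (- (\<i> *s z))" and "b = \<theta> z"
      let ?\<rho> = "graph_point \<Phi>\<^sub>2 a + pscale \<i> (graph_point \<Phi>\<^sub>2 b)"
      have ab: "\<kappa> (graph_point \<Phi>\<^sub>2 a) = graph_point \<Phi> (- (\<i> *s z))" "\<kappa> (graph_point \<Phi>\<^sub>2 b) = graph_point \<Phi> z"
        by (simp_all add: a_def b_def k_graph)
      have "hermitian_form \<Phi>\<^sub>2 ?\<rho> = - 4 * levi \<Phi> z z"
        unfolding hermitian_form_decomposition[OF spsh2] levi_image[OF strictly_psh_imp_quadratic_form[OF spsh2] q ab]
        by (simp add: levi_simps[OF q] levi_i(1)[OF q])
      then have "0 \<le> hermitian_form \<Phi>\<^sub>1 (\<kappa> ?\<rho>)"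
        using pos[of ?\<rho>] \<open>\<not> 0 < levi \<Phi> z z\<close> by simp
      moreover have "fst (\<kappa> ?\<rho>) = 0"
        unfolding image_add image_scale ab by (simp add: graph_point_def pscale_eq)
      ultimately have "?\<rho> = 0"
        using hermitian_form_vertical[OF spsh1] \<kappa>_eq_0 by blast
      then have "?\<rho> = graph_point \<Phi>\<^sub>2 0 + pscale \<i> (graph_point \<Phi>\<^sub>2 0)"
        by (simp add: linear_0[OF linear_graph_point[OF strictly_psh_imp_quadratic_form[OF spsh2]]] pscale_eq zero_prod_def)
      then have "b = 0"
        by (rule graph_decomposition_unique(2)[OF spsh2])
      then have "graph_point \<Phi> z = 0"
        using ab(2) linear_0[OF lin_k] by simp
      then show False
        using that graph_eq_0 by blast
    qed
    then show spsh: "strictly_psh_quadratic_form \<Phi>"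
      using strictly_psh_iff_levi[OF q] by blast
    have "range \<theta> = UNIV"
      by (rule surjI) (rule \<theta>_\<pi>)
    then have "\<kappa> ` Lambda \<Phi>\<^sub>2 = (\<lambda>x. ?k x) ` range \<theta>"
      by (simp only: Lambda_eq_range image_image)
    also have "\<dots> = Lambda \<Phi>"
      by (simp only: Lambda_eq_range image_image k_graph)
    finally show "\<kappa> ` Lambda \<Phi>\<^sub>2 = Lambda \<Phi>" .
    fix x
    have "0 \<le> hermitian_form \<Phi>\<^sub>1 (x, (2 / \<i>) *s g x)"
      using pos[of "graph_point \<Phi>\<^sub>2 (\<theta> x)"] by (simp only: k_\<theta> hermitian_form_graph_point[OF spsh2])
    \<comment> \<open>The choice \<open>w = 0\<close> compares the two quadratic forms, since
      \<open>Re (cdot (g x) x)\<close> is \<open>\<Phi> x\<close>.\<close>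
    also have "\<dots> \<le> 4 * (\<Phi>\<^sub>1 (x + 0) + \<Phi>\<^sub>1 (\<i> *s 0) - Re (cdot (g x) (x + 2 *\<^sub>R 0)))"
      by (rule hermitian_form_le[OF spsh1])
    also have "\<dots> = 4 * (\<Phi>\<^sub>1 x - \<Phi> x)"
      using bilinear_polar(2)[OF strictly_psh_imp_quadratic_form[OF spsh1], of 0] by (simp add: \<Phi>_def polar_def)
    finally show "\<Phi> x \<le> \<Phi>\<^sub>1 x" by simp
  qed
qed

end

theorem theorem1p1:
  fixes \<kappa> :: "(complex ^ 'n::finite) \<times> (complex ^ 'n) \<Rightarrow> (complex ^ 'n) \<times> (complex ^ 'n)"
    and \<Phi>\<^sub>1 \<Phi>\<^sub>2 :: "complex ^ 'n \<Rightarrow> real"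
  assumes "complex_linear_canonical \<kappa>"
    and "strictly_psh_quadratic_form \<Phi>\<^sub>1"
    and "strictly_psh_quadratic_form \<Phi>\<^sub>2"
  shows "positive_relative \<kappa> \<Phi>\<^sub>1 \<Phi>\<^sub>2 \<longleftrightarrow>
    (\<exists>\<Phi> :: complex ^ 'n \<Rightarrow> real.
       strictly_psh_quadratic_form \<Phi> \<and> \<kappa> ` Lambda \<Phi>\<^sub>2 = Lambda \<Phi> \<and> (\<forall>x. \<Phi> x \<le> \<Phi>\<^sub>1 x))"
proof -
  interpret canonical_transformation \<kappa> using assms(1) by unfold_locales
  show ?thesis
    using positive_if_image[OF assms(2,3)] image_if_positive[OF assms(2,3)] by metis
qed

end
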